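(* Let $1<\alpha,\beta\le2$, let $K_1^{+},K_2^{+},K_1^{-},K_2^{-}\ge0$ be constants with $(K_1^{+})^2+(K_2^{+})^2\neq0$ and $(K_1^{-})^2+(K_2^{-})^2\neq0$, let $(p,q)\in\{(1,0),(1,-1)\}$, and let $\Omega=(a,b)\times(c,d)$. Let $u$ be the exact (unique and sufficiently smooth) solution of $$\begin{cases}\frac{\partial u}{\partial t}=K_1^{+}{}_aD_x^{\alpha}u+K_2^{+}{}_xD_b^{\alpha}u+K_1^{-}{}_cD_y^{\beta}u+K_2^{-}{}_yD_d^{\beta}u+f(x,y,t), & (x,y,t)\in\Omega\times[0,T],\\ u(x,y,0)=u_0(x,y), & (x,y)\in\Omega,\\ u(x,y,t)=\varphi(x,y,t), & (x,y,t)\in\partial\Omega\times[0,T],\end{cases}$$ where $\varphi(a,y,t)=0$ if $K_1^{+}\ne0$, $\varphi(b,y,t)=0$ if $K_2^{+}\neq0$, $\varphi(x,c,t)=0$ if $K_1^{-}\ne0$, and $\varphi(x,d,t)=0$ if $K_2^{-}\neq0$. Put $u_{i,j}^n=u(x_i,y_j,t_n)$ and let $U_{i,j}^n$ be the solution of the difference scheme $$\Big(1-\frac{\tau}{2}\delta_x^\alpha\Big)\Big(1-\frac{\tau}{2}\delta_y^\beta\Big)U_{i,j}^{n+1}=\Big(1+\frac{\tau}{2}\delta_x^\alpha\Big)\Big(1+\frac{\tau}{2}\delta_y^\beta\Big)U_{i,j}^n+\tau f_{i,j}^{n+1/2},\qquad 1\le i,j\le N-1,\ 0\le n\le M-1,$$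 with $U_{i,j}^0=u_0(x_i,y_j)$ and $U_{i,j}^n=\varphi(x_i,y_j,t_n)$ at boundary grid points. Then for all $1\le n\le M$, $$\|u^n-U^n\|\le C(\tau^2+h^2),$$ where $C$ is a positive constant (independent of $n$, $\tau$ and $h$) and $\|\cdot\|$ is the discrete $L^2$-norm.
   Context: For $1<\gamma<2$, the left and right Riemann-Liouville derivatives on $[a,b]$ are ${}_aD_x^{\gamma}u(x)=\frac{1}{\Gamma(2-\gamma)}\frac{\mathrm{d}^2}{\mathrm{d}x^2}\int_a^x\frac{u(\xi)}{(x-\xi)^{\gamma-1}}\mathrm{d}\xi$ and ${}_xD_b^{\gamma}u(x)=\frac{1}{\Gamma(2-\gamma)}\frac{\mathrm{d}^2}{\mathrm{d}x^2}\int_x^b\frac{u(\xi)}{(\xi-x)^{\gamma-1}}\mathrm{d}\xi$; for $\gamma=2$ both are the second derivative; similarly in $y$ on $[c,d]$. The number of subintervals is the same in both directions, $N=N_x=N_y$, with equal step sizes $h=(b-a)/N=(d-c)/N$; $M$ is a positive integer, $\tau=T/M$, $x_i=a+ih$, $y_j=c+jh$, $t_n=n\tau$, $t_{n+1/2}=(t_n+t_{n+1})/2$, $f_{i,j}^{n+1/2}=f(x_i,y_j,t_{n+1/2})$. The discrete $L^2$-norm of a grid function $v$ vanishing at boundary grid points is $\|v\|=\sqrt{h^2\sum_{i=1}^{N-1}\sum_{j=1}^{N-1}v_{i,j}^2}$. For $\gamma\in\{\alpha,\beta\}$, with $g_0^{(\gamma)}=1$, $g_k^{(\gamma)}=\left(1-\frac{\gamma+1}{k}\right)g_{k-1}^{(\gamma)}$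 ($k\ge1$), the coefficients are: for $(p,q)=(1,0)$: $w_0^{(\gamma)}=\frac{\gamma}{2}g_0^{(\gamma)}$, $w_k^{(\gamma)}=\frac{\gamma}{2}g_k^{(\gamma)}+\frac{2-\gamma}{2}g_{k-1}^{(\gamma)}$ for $k\ge1$; for $(p,q)=(1,-1)$: $w_0^{(\gamma)}=\frac{2+\gamma}{4}g_0^{(\gamma)}$, $w_1^{(\gamma)}=\frac{2+\gamma}{4}g_1^{(\gamma)}$, $w_k^{(\gamma)}=\frac{2+\gamma}{4}g_k^{(\gamma)}+\frac{2-\gamma}{4}g_{k-2}^{(\gamma)}$ for $k\ge2$. The difference operators are $$\delta_x^\alpha U_{i,j}=\frac{1}{h^\alpha}\Big(K_1^{+}\sum_{k=0}^{i+1}w_k^{(\alpha)}U_{i-k+1,j}+K_2^{+}\sum_{k=0}^{N-i+1}w_k^{(\alpha)}U_{i+k-1,j}\Big),\quad \delta_y^\beta U_{i,j}=\frac{1}{h^\beta}\Big(K_1^{-}\sum_{k=0}^{j+1}w_k^{(\beta)}U_{i,j-k+1}+K_2^{-}\sum_{k=0}^{N-j+1}w_k^{(\beta)}U_{i,j+k-1}\Big).$$ Standing assumption: the problem has a unique and sufficiently smooth solution $u$. "Sufficiently smooth" is understood so that the scheme is consistent of second order, i.e. when the exact values $u_{i,j}^n$ are substituted for $U_{i,j}^n$ in the scheme the equation holds with an additional term $\tau\varepsilon_{i,j}^n$ on the right-hand side, where $|\varepsilon_{i,j}^n|\le\tilde c(\tau^2+h^2)$ with $\tilde c$ independent of $i,j,n,\tau,h$.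 *)

theory Defs
  imports "HOL-Analysis.Analysis"
begin

definition left_RL_integral :: "real \<Rightarrow> real \<Rightarrow> (real \<Rightarrow> real) \<Rightarrow> real \<Rightarrow> real" where
  "left_RL_integral \<gamma> a v x = integral {a..x} (\<lambda>\<xi>. v \<xi> / (x - \<xi>) powr (\<gamma> - 1))"

definition right_RL_integral :: "real \<Rightarrow> real \<Rightarrow> (real \<Rightarrow> real) \<Rightarrow> real \<Rightarrow> real" where
  "right_RL_integral \<gamma> b v x = integral {x..b} (\<lambda>\<xi>. v \<xi> / (\<xi> - x) powr (\<gamma> - 1))"

definition left_RL_deriv :: "real \<Rightarrow> real \<Rightarrow> (real \<Rightarrow> real) \<Rightarrow> real \<Rightarrow> real" where
  "left_RL_deriv \<gamma> a v x =
     (if \<gamma> = 2 then deriv (deriv v) x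
      else 1 / Gamma (2 - \<gamma>) * deriv (deriv (left_RL_integral \<gamma> a v)) x)"

definition right_RL_deriv :: "real \<Rightarrow> real \<Rightarrow> (real \<Rightarrow> real) \<Rightarrow> real \<Rightarrow> real" where
  "right_RL_deriv \<gamma> b v x =
     (if \<gamma> = 2 then deriv (deriv v) x
      else 1 / Gamma (2 - \<gamma>) * deriv (deriv (right_RL_integral \<gamma> b v)) x)"

text \<open>Since \<^const>\<open>integral\<close> and \<^const>\<open>deriv\<close> are total, existence of the derivatives is
  recorded separately.\<close>

definition twice_differentiable_at :: "(real \<Rightarrow> real) \<Rightarrow> real \<Rightarrow> bool" where
  "twice_differentiable_at v x \<longleftrightarrow>
     (\<forall>\<^sub>F z in nhds x. v field_differentiable (at z)) \<and> deriv v field_differentiable (at x)"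

definition left_RL_exists :: "real \<Rightarrow> real \<Rightarrow> (real \<Rightarrow> real) \<Rightarrow> real \<Rightarrow> bool" where
  "left_RL_exists \<gamma> a v x \<longleftrightarrow>
     (if \<gamma> = 2 then twice_differentiable_at v x
      else (\<forall>\<^sub>F z in nhds x. (\<lambda>\<xi>. v \<xi> / (z - \<xi>) powr (\<gamma> - 1)) integrable_on {a..z}) \<and>
           twice_differentiable_at (left_RL_integral \<gamma> a v) x)"

definition right_RL_exists :: "real \<Rightarrow> real \<Rightarrow> (real \<Rightarrow> real) \<Rightarrow> real \<Rightarrow> bool" where
  "right_RL_exists \<gamma> b v x \<longleftrightarrow>
     (if \<gamma> = 2 then twice_differentiable_at v x
      else (\<forall>\<^sub>F z in nhds x. (\<lambda>\<xi>. v \<xi> / (\<xi> - z) powr (\<gamma> - 1)) integrable_on {z..b}) \<and>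
           twice_differentiable_at (right_RL_integral \<gamma> b v) x)"

text \<open>The initial-boundary value problem on \<open>\<Omega> = (a,b) \<times> (c,d)\<close>; \<open>K1p, K2p, K1m, K2m\<close> stand for
  \<open>K\<^sub>1\<^sup>+, K\<^sub>2\<^sup>+, K\<^sub>1\<^sup>-, K\<^sub>2\<^sup>-\<close>. A fractional derivative has to exist only if its coefficient is
  nonzero; the time derivative is one-sided at \<open>t = 0\<close> and \<open>t = T\<close>.\<close>

definition solves_problem ::
  "real \<Rightarrow> real \<Rightarrow> real \<Rightarrow> real \<Rightarrow> real \<Rightarrow> real \<Rightarrow> real \<Rightarrow> real \<Rightarrow> real \<Rightarrow> real \<Rightarrow> real \<Rightarrow>
   (real \<Rightarrow> real \<Rightarrow> real \<Rightarrow> real) \<Rightarrow> (real \<Rightarrow> real \<Rightarrow> real) \<Rightarrow> (real \<Rightarrow> real \<Rightarrow> real \<Rightarrow> real) \<Rightarrow>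
   (real \<Rightarrow> real \<Rightarrow> real \<Rightarrow> real) \<Rightarrow> bool" where
  "solves_problem a b c d T \<alpha> \<beta> K1p K2p K1m K2m f u0 \<phi> u \<longleftrightarrow>
     (\<forall>x\<in>{a<..<b}. \<forall>y\<in>{c<..<d}. \<forall>t\<in>{0..T}.
        (K1p \<noteq> 0 \<longrightarrow> left_RL_exists \<alpha> a (\<lambda>\<xi>. u \<xi> y t) x) \<and>
        (K2p \<noteq> 0 \<longrightarrow> right_RL_exists \<alpha> b (\<lambda>\<xi>. u \<xi> y t) x) \<and>
        (K1m \<noteq> 0 \<longrightarrow> left_RL_exists \<beta> c (\<lambda>\<eta>. u x \<eta> t) y) \<and>
        (K2m \<noteq> 0 \<longrightarrow> right_RL_exists \<beta> d (\<lambda>\<eta>. u x \<eta> t) y) \<and>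
        ((\<lambda>s. u x y s) has_real_derivative
           (K1p * left_RL_deriv \<alpha> a (\<lambda>\<xi>. u \<xi> y t) x + K2p * right_RL_deriv \<alpha> b (\<lambda>\<xi>. u \<xi> y t) x
            + K1m * left_RL_deriv \<beta> c (\<lambda>\<eta>. u x \<eta> t) y + K2m * right_RL_deriv \<beta> d (\<lambda>\<eta>. u x \<eta> t) y
            + f x y t)) (at t within {0..T})) \<and>
     (\<forall>x\<in>{a<..<b}. \<forall>y\<in>{c<..<d}. u x y 0 = u0 x y) \<and>
     (\<forall>(x, y)\<in>frontier ({a<..<b} \<times> {c<..<d}). \<forall>t\<in>{0..T}. u x y t = \<phi> x y t)"

primrec grunwald_coeff :: "real \<Rightarrow> nat \<Rightarrow> real" where
  "grunwald_coeff \<gamma> 0 = 1"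
| "grunwald_coeff \<gamma> (Suc k) = (1 - (\<gamma> + 1) / real (Suc k)) * grunwald_coeff \<gamma> k"

text \<open>Only the shift pairs \<open>(1, 0)\<close> and \<open>(1, -1)\<close> are meaningful.\<close>

definition wsgd_coeff :: "int \<times> int \<Rightarrow> real \<Rightarrow> nat \<Rightarrow> real" where
  "wsgd_coeff pq \<gamma> k =
     (if pq = (1, 0) then
        \<gamma> / 2 * grunwald_coeff \<gamma> k
        + (if k \<ge> 1 then (2 - \<gamma>) / 2 * grunwald_coeff \<gamma> (k - 1) else 0)
      else if pq = (1, -1) then
        (2 + \<gamma>) / 4 * grunwald_coeff \<gamma> k
        + (if k \<ge> 2 then (2 - \<gamma>) / 4 * grunwald_coeff \<gamma> (k - 2) else 0)
      else 0)"

text \<open>The operator is applied only at \<open>1 \<le> i \<le> N - 1\<close>, where the index subtractions do not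
  truncate.\<close>

definition wsgd_diff ::
  "int \<times> int \<Rightarrow> real \<Rightarrow> real \<Rightarrow> real \<Rightarrow> real \<Rightarrow> nat \<Rightarrow> (nat \<Rightarrow> real) \<Rightarrow> nat \<Rightarrow> real" where
  "wsgd_diff pq \<gamma> K1 K2 h N V i =
     1 / h powr \<gamma> *
       (K1 * (\<Sum>k=0..i + 1. wsgd_coeff pq \<gamma> k * V (i + 1 - k))
        + K2 * (\<Sum>k=0..N - i + 1. wsgd_coeff pq \<gamma> k * V (i + k - 1)))"

type_synonym grid = "nat \<Rightarrow> nat \<Rightarrow> real"

definition delta_x ::
  "int \<times> int \<Rightarrow> real \<Rightarrow> real \<Rightarrow> real \<Rightarrow> real \<Rightarrow> nat \<Rightarrow> grid \<Rightarrow> grid" where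
  "delta_x pq \<alpha> K1p K2p h N U = (\<lambda>i j. wsgd_diff pq \<alpha> K1p K2p h N (\<lambda>k. U k j) i)"

definition delta_y ::
  "int \<times> int \<Rightarrow> real \<Rightarrow> real \<Rightarrow> real \<Rightarrow> real \<Rightarrow> nat \<Rightarrow> grid \<Rightarrow> grid" where
  "delta_y pq \<beta> K1m K2m h N U = (\<lambda>i j. wsgd_diff pq \<beta> K1m K2m h N (\<lambda>k. U i k) j)"

definition id_plus :: "real \<Rightarrow> (grid \<Rightarrow> grid) \<Rightarrow> grid \<Rightarrow> grid" where
  "id_plus s D U = (\<lambda>i j. U i j + s * D U i j)"

text \<open>\<open>F\<close> is the source term sampled at the half time step.\<close>

definition scheme_lhs :: "(grid \<Rightarrow> grid) \<Rightarrow> (grid \<Rightarrow> grid) \<Rightarrow> real \<Rightarrow> grid \<Rightarrow> grid" where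
  "scheme_lhs dx dy \<tau> U = id_plus (- \<tau> / 2) dx (id_plus (- \<tau> / 2) dy U)"

definition scheme_rhs :: "(grid \<Rightarrow> grid) \<Rightarrow> (grid \<Rightarrow> grid) \<Rightarrow> real \<Rightarrow> grid \<Rightarrow> grid \<Rightarrow> grid" where
  "scheme_rhs dx dy \<tau> F U = (\<lambda>i j. id_plus (\<tau> / 2) dx (id_plus (\<tau> / 2) dy U) i j + \<tau> * F i j)"

definition on_grid :: "real \<Rightarrow> real \<Rightarrow> real \<Rightarrow> (real \<Rightarrow> real \<Rightarrow> real \<Rightarrow> real) \<Rightarrow> real \<Rightarrow> grid" where
  "on_grid a c h v t = (\<lambda>i j. v (a + real i * h) (c + real j * h) t)"

definition half_time :: "real \<Rightarrow> nat \<Rightarrow> real" where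
  "half_time \<tau> n = (real n * \<tau> + real (n + 1) * \<tau>) / 2"

definition solves_scheme ::
  "int \<times> int \<Rightarrow> real \<Rightarrow> real \<Rightarrow> real \<Rightarrow> real \<Rightarrow> real \<Rightarrow> real \<Rightarrow> real \<Rightarrow> real \<Rightarrow> real \<Rightarrow> real \<Rightarrow>
   (real \<Rightarrow> real \<Rightarrow> real \<Rightarrow> real) \<Rightarrow> (real \<Rightarrow> real \<Rightarrow> real) \<Rightarrow> (real \<Rightarrow> real \<Rightarrow> real \<Rightarrow> real) \<Rightarrow>
   nat \<Rightarrow> nat \<Rightarrow> (nat \<Rightarrow> grid) \<Rightarrow> bool" where
  "solves_scheme pq a b c T \<alpha> \<beta> K1p K2p K1m K2m f u0 \<phi> N M U \<longleftrightarrow>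
     (let h = (b - a) / real N; \<tau> = T / real M;
          dx = delta_x pq \<alpha> K1p K2p h N; dy = delta_y pq \<beta> K1m K2m h N in
      (\<forall>n<M. \<forall>i\<in>{1..N - 1}. \<forall>j\<in>{1..N - 1}.
         scheme_lhs dx dy \<tau> (U (n + 1)) i j =
         scheme_rhs dx dy \<tau> (on_grid a c h f (half_time \<tau> n)) (U n) i j) \<and>
      (\<forall>i\<in>{1..N - 1}. \<forall>j\<in>{1..N - 1}. U 0 i j = u0 (a + real i * h) (c + real j * h)) \<and>
      (\<forall>n\<le>M. \<forall>i\<le>N. \<forall>j\<le>N. i = 0 \<or> i = N \<or> j = 0 \<or> j = N \<longrightarrow>
         U n i j = on_grid a c h \<phi> (real n * \<tau>) i j))"

definition consistent_second_order ::
  "int \<times> int \<Rightarrow> real \<Rightarrow> real \<Rightarrow> real \<Rightarrow> real \<Rightarrow> real \<Rightarrow> real \<Rightarrow> real \<Rightarrow> real \<Rightarrow> real \<Rightarrow> real \<Rightarrow>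
   (real \<Rightarrow> real \<Rightarrow> real \<Rightarrow> real) \<Rightarrow> (real \<Rightarrow> real \<Rightarrow> real \<Rightarrow> real) \<Rightarrow> bool" where
  "consistent_second_order pq a b c T \<alpha> \<beta> K1p K2p K1m K2m f u \<longleftrightarrow>
     (\<exists>ctil. \<forall>N\<ge>1. \<forall>M\<ge>1.
        let h = (b - a) / real N; \<tau> = T / real M;
            dx = delta_x pq \<alpha> K1p K2p h N; dy = delta_y pq \<beta> K1m K2m h N in
        \<exists>\<epsilon> :: nat \<Rightarrow> grid. \<forall>n<M. \<forall>i\<in>{1..N - 1}. \<forall>j\<in>{1..N - 1}.
          scheme_lhs dx dy \<tau> (on_grid a c h u (real (n + 1) * \<tau>)) i j =
          scheme_rhs dx dy \<tau> (on_grid a c h f (half_time \<tau> n)) (on_grid a c h u (real n * \<tau>)) i j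
            + \<tau> * \<epsilon> n i j \<and>
          \<bar>\<epsilon> n i j\<bar> \<le> ctil * (\<tau>\<^sup>2 + h\<^sup>2))"

text \<open>A sufficiently smooth solution is one that is continuous up to the boundary and smooth enough
  for the scheme to be consistent of second order. Uniqueness is
  meant within this class, on the closed space-time domain.\<close>

definition smooth_solution ::
  "int \<times> int \<Rightarrow> real \<Rightarrow> real \<Rightarrow> real \<Rightarrow> real \<Rightarrow> real \<Rightarrow> real \<Rightarrow> real \<Rightarrow> real \<Rightarrow> real \<Rightarrow> real \<Rightarrow> real \<Rightarrow>
   (real \<Rightarrow> real \<Rightarrow> real \<Rightarrow> real) \<Rightarrow> (real \<Rightarrow> real \<Rightarrow> real) \<Rightarrow> (real \<Rightarrow> real \<Rightarrow> real \<Rightarrow> real) \<Rightarrow>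
   (real \<Rightarrow> real \<Rightarrow> real \<Rightarrow> real) \<Rightarrow> bool" where
  "smooth_solution pq a b c d T \<alpha> \<beta> K1p K2p K1m K2m f u0 \<phi> u \<longleftrightarrow>
     solves_problem a b c d T \<alpha> \<beta> K1p K2p K1m K2m f u0 \<phi> u \<and>
     continuous_on ({a..b} \<times> {c..d} \<times> {0..T}) (\<lambda>(x, y, t). u x y t) \<and>
     consistent_second_order pq a b c T \<alpha> \<beta> K1p K2p K1m K2m f u"

definition exact_solution ::
  "int \<times> int \<Rightarrow> real \<Rightarrow> real \<Rightarrow> real \<Rightarrow> real \<Rightarrow> real \<Rightarrow> real \<Rightarrow> real \<Rightarrow> real \<Rightarrow> real \<Rightarrow> real \<Rightarrow> real \<Rightarrow>
   (real \<Rightarrow> real \<Rightarrow> real \<Rightarrow> real) \<Rightarrow> (real \<Rightarrow> real \<Rightarrow> real) \<Rightarrow> (real \<Rightarrow> real \<Rightarrow> real \<Rightarrow> real) \<Rightarrow>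
   (real \<Rightarrow> real \<Rightarrow> real \<Rightarrow> real) \<Rightarrow> bool" where
  "exact_solution pq a b c d T \<alpha> \<beta> K1p K2p K1m K2m f u0 \<phi> u \<longleftrightarrow>
     smooth_solution pq a b c d T \<alpha> \<beta> K1p K2p K1m K2m f u0 \<phi> u \<and>
     (\<forall>v. smooth_solution pq a b c d T \<alpha> \<beta> K1p K2p K1m K2m f u0 \<phi> v \<longrightarrow>
        (\<forall>x\<in>{a..b}. \<forall>y\<in>{c..d}. \<forall>t\<in>{0..T}. v x y t = u x y t))"

definition discrete_L2_norm :: "real \<Rightarrow> nat \<Rightarrow> grid \<Rightarrow> real" where
  "discrete_L2_norm h N v = sqrt (h\<^sup>2 * (\<Sum>i=1..N - 1. \<Sum>j=1..N - 1. (v i j)\<^sup>2))"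

end

theory Submission
  imports Defs
begin

text \<open>Let \<open>A\<close> and \<open>B\<close> be the difference operators \<open>\<tau>/2 \<delta>\<^sub>x\<close> and \<open>\<tau>/2 \<delta>\<^sub>y\<close> on grid functions vanishing on
  the boundary. They commute, and both are dissipative, so \<open>\<parallel>(1 + A) v\<parallel> \<le> \<parallel>(1 - A) v\<parallel>\<close> and
  \<open>\<parallel>v\<parallel> \<le> \<parallel>(1 - A) v\<parallel>\<close>, likewise for \<open>B\<close>. The error \<open>e = u - U\<close> solves the scheme with source
  \<open>\<epsilon>\<close>, so its energy \<open>\<parallel>(1 - A) (1 - B) e\<parallel>\<close> grows by at most \<open>\<tau> \<parallel>\<epsilon>\<parallel>\<close> per step; this energy dominates
  \<open>\<parallel>e\<parallel>\<close>. For dissipativity, the quadratic form of the operator is a combination of autocorrelations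
  \<open>S m\<close> of the grid function extended by zero. In terms of \<open>S 0 - S m \<ge> 0\<close> the only weight of the
  wrong sign is the one at distance 2, and \<open>S 0 - S 2 \<le> 4 (S 0 - S 1)\<close> absorbs it.\<close>

section \<open>Signs and partial sums of the coefficients\<close>

lemma grunwald_coeff_nonneg:
  assumes "1 \<le> \<gamma>" "\<gamma> \<le> 2" "2 \<le> k"
  shows "0 \<le> grunwald_coeff \<gamma> k"
  using assms(3)
proof (induction k rule: dec_induct)
  case base
  have "grunwald_coeff \<gamma> 2 = \<gamma> * (\<gamma> - 1) / 2"
    by (simp add: numeral_2_eq_2 field_simps)
  moreover have "0 \<le> \<gamma> * (\<gamma> - 1) / 2"
    using assms by simp
  ultimately show ?case by metis
next
  case (step k)
  \<comment> \<open>The step starts from k \<ge> 2, so \<open>Suc k\<close> is at least 3 \<ge>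
    \<gamma> + 1.\<close>
  then have "0 \<le> 1 - (\<gamma> + 1) / real (Suc k)"
    using assms by (simp add: field_simps)
  with step show ?case by simp
qed

text \<open>The partial sum up to n has a closed form: times - \<gamma> it equals (n + 1) times the
  coefficient with index n + 1. That coefficient is nonnegative as soon as n \<ge> 1.\<close>

lemma sum_grunwald_coeff_nonpos:
  assumes "1 \<le> \<gamma>" "\<gamma> \<le> 2" "1 \<le> n"
  shows "(\<Sum>k\<le>n. grunwald_coeff \<gamma> k) \<le> 0"
proof -
  have "grunwald_coeff \<gamma> (Suc n) * real (Suc n) = - \<gamma> * (\<Sum>k\<le>n. grunwald_coeff \<gamma> k)" for n
  proof (induction n)
    case (Suc n)
    have "grunwald_coeff \<gamma> (Suc (Suc n)) * real (Suc (Suc n))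
        = (real (Suc (Suc n)) - (\<gamma> + 1)) * grunwald_coeff \<gamma> (Suc n)"
      by (subst grunwald_coeff.simps(2)) (simp add: diff_divide_distrib[symmetric] right_diff_distrib left_diff_distrib
          del: grunwald_coeff.simps of_nat_Suc)
    also have "\<dots> = grunwald_coeff \<gamma> (Suc n) * real (Suc n) - \<gamma> * grunwald_coeff \<gamma> (Suc n)"
      by (simp add: algebra_simps del: grunwald_coeff.simps)
    also have "\<dots> = - \<gamma> * (\<Sum>k\<le>Suc n. grunwald_coeff \<gamma> k)"
      unfolding Suc.IH by (simp add: algebra_simps del: grunwald_coeff.simps)
    finally show ?case .
  qed simp
  moreover have "0 \<le> grunwald_coeff \<gamma> (Suc n) * real (Suc n)"
    using grunwald_coeff_nonneg[of \<gamma> "Suc n"] assms by simp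
  ultimately have "\<gamma> * (\<Sum>k\<le>n. grunwald_coeff \<gamma> k) \<le> 0" by simp
  then show ?thesis using assms by (simp add: mult_le_0_iff)
qed

text \<open>The factor 4 comes from \<open>S 0 - S 2 \<le> 4 (S 0 - S 1)\<close>: for the shifts \<open>(1, -1)\<close> the weight \<open>w 3\<close> is
  negative.\<close>

definition dissipative_weights :: "(nat \<Rightarrow> real) \<Rightarrow> bool" where
  "dissipative_weights w \<longleftrightarrow> 0 \<le> w 0 + w 2 \<and> 0 \<le> w 0 + w 2 + 4 * w 3 \<and>
     (\<forall>k\<ge>4. 0 \<le> w k) \<and> (\<forall>n\<ge>3. (\<Sum>k\<le>n. w k) \<le> 0)"

lemma sum_shift_Suc:
  fixes g :: "nat \<Rightarrow> real"
  assumes "s \<le> n"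
  shows "(\<Sum>k\<le>n. if s \<le> k then g (k - s) else 0) = (\<Sum>k\<le>n - s. g k)"
proof -
  have "(\<Sum>k\<le>n. if s \<le> k then g (k - s) else 0) = (\<Sum>k\<in>{s..n}. g (k - s))"
    by (rule sum.mono_neutral_cong_right) auto
  also have "\<dots> = (\<Sum>k\<le>n - s. g k)"
    by (rule sum.reindex_bij_witness[of _ "\<lambda>k. k + s" "\<lambda>k. k - s"]) (use assms in auto)
  finally show ?thesis .
qed

text \<open>The weights are convex combinations of two shifted copies of the Grunwald coefficients,
  hence so are their partial sums; n \<ge> 3 keeps the shifted partial sum at an upper index of at
  least 1. For (1, 0) the weight with index 3 is itself nonnegative, so only (1, -1) needs a genuine
  estimate of the combination with factor 4.\<close>

lemma dissipative_weights_wsgd_coeff: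
  assumes "pq \<in> {(1, 0), (1, -1)}" "1 \<le> \<gamma>" "\<gamma> \<le> 2"
  shows "dissipative_weights (wsgd_coeff pq \<gamma>)"
proof -
  let ?g = "grunwald_coeff \<gamma>"
  have g: "?g 0 = 1" "?g 1 = - \<gamma>" "?g 2 = \<gamma> * (\<gamma> - 1) / 2" "?g 3 = \<gamma> * (\<gamma> - 1) * (2 - \<gamma>) / 6"
    by (simp_all add: numeral_2_eq_2 numeral_3_eq_3 field_simps)
  note nn = grunwald_coeff_nonneg[OF assms(2,3)] and sn = sum_grunwald_coeff_nonpos[OF assms(2,3)]
  have gn: "0 \<le> ?g 3" "0 \<le> ?g 2" by (simp_all add: nn)
  show ?thesis
  proof (cases "pq = (1, 0)")
    case True
    have w: "wsgd_coeff pq \<gamma> k = \<gamma> / 2 * ?g k + (2 - \<gamma>) / 2 * (if 1 \<le> k then ?g (k - 1) else 0)" for k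
      by (simp add: True wsgd_coeff_def)
    have w02: "wsgd_coeff pq \<gamma> 0 + wsgd_coeff pq \<gamma> 2 = \<gamma> * ((\<gamma> - 1) * (\<gamma> + 2)) / 4"
      by (simp add: w g del: grunwald_coeff.simps) (simp add: field_simps)
    have "0 \<le> wsgd_coeff pq \<gamma> 0 + wsgd_coeff pq \<gamma> 2"
      unfolding w02 using assms by (intro divide_nonneg_nonneg mult_nonneg_nonneg) auto
    moreover have "0 \<le> wsgd_coeff pq \<gamma> 3"
      using gn assms by (simp add: w)
    moreover have "0 \<le> wsgd_coeff pq \<gamma> k" if "4 \<le> k" for k
      using that assms nn[of k] nn[of "k - 1"] by (simp add: w)
    moreover have "(\<Sum>k\<le>n. wsgd_coeff pq \<gamma> k) \<le> 0" if "3 \<le> n" for n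
    proof -
      have "(\<Sum>k\<le>n. wsgd_coeff pq \<gamma> k) = \<gamma> / 2 * (\<Sum>k\<le>n. ?g k) + (2 - \<gamma>) / 2 * (\<Sum>k\<le>n - 1. ?g k)"
        using that by (simp only: w sum.distrib sum_distrib_left[symmetric] sum_shift_Suc)
      also have "\<dots> \<le> 0"
        using that assms sn[of n] sn[of "n - 1"] by (intro add_nonpos_nonpos mult_nonneg_nonpos) auto
      finally show ?thesis .
    qed
    ultimately show ?thesis
      by (simp add: dissipative_weights_def)
  next
    case False
    have w: "wsgd_coeff pq \<gamma> k = (2 + \<gamma>) / 4 * ?g k + (2 - \<gamma>) / 4 * (if 2 \<le> k then ?g (k - 2) else 0)" for k
      using False assms by (auto simp: wsgd_coeff_def)
    have w02: "wsgd_coeff pq \<gamma> 0 + wsgd_coeff pq \<gamma> 2 = 1 + \<gamma> * ((\<gamma> - 1) * (\<gamma> + 2)) / 8"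
      by (simp add: w g del: grunwald_coeff.simps) (simp add: field_simps)
    have w3: "wsgd_coeff pq \<gamma> 3 = \<gamma> * (2 - \<gamma>) * (\<gamma>\<^sup>2 + \<gamma> - 8) / 24"
    proof -
      have "wsgd_coeff pq \<gamma> 3 = (2 + \<gamma>) / 4 * ?g 3 + (2 - \<gamma>) / 4 * ?g 1"
        by (simp add: w)
      then show ?thesis
        unfolding g by (simp add: field_simps power2_eq_square)
    qed
    have "0 \<le> wsgd_coeff pq \<gamma> 0 + wsgd_coeff pq \<gamma> 2"
      unfolding w02 using assms by (intro add_nonneg_nonneg divide_nonneg_nonneg mult_nonneg_nonneg) auto
    \<comment> \<open>The combination to be bounded vanishes at \<gamma> = 1. Expanding around that
      point leaves only terms that are nonnegative for 0 \<le> s \<le> 1.\<close>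
    moreover define s where "s = \<gamma> - 1"
    have "0 \<le> wsgd_coeff pq \<gamma> 0 + wsgd_coeff pq \<gamma> 2 + 4 * wsgd_coeff pq \<gamma> 3"
    proof -
      have "wsgd_coeff pq \<gamma> 0 + wsgd_coeff pq \<gamma> 2 + 4 * wsgd_coeff pq \<gamma> 3
         = 1 + \<gamma> * ((\<gamma> - 1) * (\<gamma> + 2)) / 8 + \<gamma> * (2 - \<gamma>) * (\<gamma>\<^sup>2 + \<gamma> - 8) / 6"
        by (simp only: w02 w3)
      also have "\<dots> = 7 / 8 * s + 9 / 8 * s\<^sup>2 + 3 / 8 * (s\<^sup>2 * (1 - s)) + 1 / 6 * (s\<^sup>2 * (1 - s) * (1 + s))"
        by (simp add: s_def field_simps power2_eq_square)
      also have "\<dots> \<ge> 0"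
        using assms unfolding s_def by (intro add_nonneg_nonneg mult_nonneg_nonneg) auto
      finally show ?thesis .
    qed
    moreover have "0 \<le> wsgd_coeff pq \<gamma> k" if "4 \<le> k" for k
      using that assms nn[of k] nn[of "k - 2"] by (simp add: w)
    moreover have "(\<Sum>k\<le>n. wsgd_coeff pq \<gamma> k) \<le> 0" if "3 \<le> n" for n
    proof -
      have "(\<Sum>k\<le>n. wsgd_coeff pq \<gamma> k) = (2 + \<gamma>) / 4 * (\<Sum>k\<le>n. ?g k) + (2 - \<gamma>) / 4 * (\<Sum>k\<le>n - 2. ?g k)"
        using that by (simp only: w sum.distrib sum_distrib_left[symmetric] sum_shift_Suc)
      also have "\<dots> \<le> 0"
        using that assms sn[of n] sn[of "n - 2"] by (intro add_nonpos_nonpos mult_nonneg_nonpos) auto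
      finally show ?thesis .
    qed
    ultimately show ?thesis
      by (simp add: dissipative_weights_def)
  qed
qed

section \<open>Autocorrelations and dissipativity in one dimension\<close>

definition autocorrelation :: "(int \<Rightarrow> real) \<Rightarrow> int \<Rightarrow> real" where
  "autocorrelation v m = (\<Sum>\<^sub>\<infinity>i. v i * v (i + m))"

text \<open>Summation over all integers is translation invariant, so only the difference of the two
  shifts matters and no boundary terms arise. Finite support provides summability.\<close>

lemma has_sum_autocorrelation:
  assumes "finite {i. v i \<noteq> 0}"
  shows "((\<lambda>i. v (i + l) * v (i + m)) has_sum autocorrelation v (m - l)) UNIV"
proof -
  have "((\<lambda>i. v i * v (i + (m - l))) has_sum autocorrelation v (m - l)) UNIV"
    unfolding autocorrelation_def
    by (intro has_sum_infsum finite_nonzero_values_imp_summable_on finite_subset[OF _ assms]) auto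
  moreover have "bij_betw (\<lambda>i. i + l) UNIV UNIV"
    by (rule bij_betwI[of _ _ _ "\<lambda>i. i - l"]) auto
  ultimately show ?thesis
    using has_sum_reindex_bij_betw[of "\<lambda>i. i + l" UNIV UNIV "\<lambda>i. v i * v (i + (m - l))"]
    by (simp add: algebra_simps)
qed

text \<open>Translation by m exchanges the two factors. This symmetry gives the left-sided and the
  right-sided operator the same quadratic form.\<close>

lemma autocorrelation_minus:
  assumes "finite {i. v i \<noteq> 0}"
  shows "autocorrelation v (- m) = autocorrelation v m"
  using has_sum_unique has_sum_autocorrelation[OF assms, of m 0] has_sum_autocorrelation[OF assms, of 0 m]
  by (fastforce simp: mult.commute)

text \<open>Twice the difference of the two sides is the sum of the squares of
  \<open>v i - v (i + m)\<close>.\<close>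

lemma autocorrelation_le_0:
  assumes "finite {i. v i \<noteq> 0}"
  shows "autocorrelation v m \<le> autocorrelation v 0"
proof -
  note S = has_sum_autocorrelation[OF assms]
  have "((\<lambda>i. v (i + 0) * v (i + 0) + v (i + m) * v (i + m) + (-2) * (v (i + 0) * v (i + m)))
      has_sum (autocorrelation v (0 - 0) + autocorrelation v (m - m) + (-2) * autocorrelation v (m - 0))) UNIV"
    by (intro has_sum_add has_sum_cmult_right S)
  then have "0 \<le> autocorrelation v (0 - 0) + autocorrelation v (m - m) + (-2) * autocorrelation v (m - 0)"
  proof (rule has_sum_nonneg)
    fix i
    have "v (i + 0) * v (i + 0) + v (i + m) * v (i + m) + (-2) * (v (i + 0) * v (i + m)) = (v i - v (i + m))\<^sup>2"
      by (simp add: power2_eq_square algebra_simps)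
    then show "0 \<le> v (i + 0) * v (i + 0) + v (i + m) * v (i + m) + (-2) * (v (i + 0) * v (i + m))"
      by simp
  qed
  then show ?thesis by simp
qed

text \<open>Twice the right-hand side is the sum of the squared second differences of \<open>v\<close>.\<close>

lemma autocorrelation_second_difference_nonneg:
  assumes "finite {i. v i \<noteq> 0}"
  shows "0 \<le> 3 * autocorrelation v 0 - 4 * autocorrelation v 1 + autocorrelation v 2"
proof -
  note S = has_sum_autocorrelation[OF assms]
  let ?f = "\<lambda>i. v (i + 0) * v (i + 0) + 4 * (v (i + 1) * v (i + 1)) + v (i + 2) * v (i + 2)
      + (-4) * (v (i + 0) * v (i + 1)) + (-4) * (v (i + 1) * v (i + 2)) + 2 * (v (i + 0) * v (i + 2))"
  let ?s = "autocorrelation v (0 - 0) + 4 * autocorrelation v (1 - 1) + autocorrelation v (2 - 2)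
      + (-4) * autocorrelation v (1 - 0) + (-4) * autocorrelation v (2 - 1) + 2 * autocorrelation v (2 - 0)"
  have "(?f has_sum ?s) UNIV"
    by (intro has_sum_add has_sum_cmult_right S)
  then have "0 \<le> ?s"
  proof (rule has_sum_nonneg)
    fix i
    have "?f i = (v i - 2 * v (i + 1) + v (i + 2))\<^sup>2"
      by (simp add: power2_eq_square algebra_simps)
    then show "0 \<le> ?f i" by (metis zero_le_power2)
  qed
  then show ?thesis by simp
qed

text \<open>Writing each autocorrelation as S 0 minus a defect \<open>D k\<close> splits the sum
  into S 0 times the sum of the weights, which is nonpositive, minus the weighted sum of the
  defects. The weight \<open>w k\<close> acts at distance k - 1, so \<open>w 1\<close> meets a zero
  defect, \<open>w 0\<close> and \<open>w 2\<close> share the defect at distance 1, and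
  \<open>w 3\<close> belongs to distance 2.\<close>

lemma dissipative_weights_autocorrelation:
  assumes "dissipative_weights w" "finite {i. v i \<noteq> 0}" "3 \<le> n"
  shows "(\<Sum>k\<le>n. w k * autocorrelation v (int k - 1)) \<le> 0"
proof -
  define D where "D k = autocorrelation v 0 - autocorrelation v (int k - 1)" for k
  have D_nonneg: "0 \<le> D k" for k
    using autocorrelation_le_0[OF assms(2)] by (simp add: D_def)
  have "D 0 = D 2"
    using autocorrelation_minus[OF assms(2), of 1] by (simp add: D_def)
  have "D 1 = 0" by (simp add: D_def)
  have "D 3 \<le> 4 * D 2"
    using autocorrelation_second_difference_nonneg[OF assms(2)] by (simp add: D_def)
  have w: "0 \<le> w 0 + w 2" "0 \<le> w 0 + w 2 + 4 * w 3" "\<And>k. 4 \<le> k \<Longrightarrow> 0 \<le> w k" "(\<Sum>k\<le>n. w k) \<le> 0"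
    using assms(1,3) by (auto simp: dissipative_weights_def)
  \<comment> \<open>If \<open>w 3\<close> is negative, replacing \<open>D 3\<close> by its upper
    bound \<open>4 * D 2\<close> only lowers the value and leaves a multiple of
    \<open>D 2\<close>.\<close>
  have "0 \<le> (w 0 + w 2) * D 2 + w 3 * D 3"
  proof (cases "0 \<le> w 3")
    case True
    then show ?thesis using w D_nonneg by simp
  next
    case False
    then have "w 3 * (4 * D 2) \<le> w 3 * D 3"
      using \<open>D 3 \<le> 4 * D 2\<close> by (intro mult_left_mono_neg) auto
    moreover have "0 \<le> (w 0 + w 2 + 4 * w 3) * D 2"
      using w D_nonneg by simp
    ultimately show ?thesis by (simp add: algebra_simps)
  qed
  moreover have "0 \<le> (\<Sum>k\<in>{4..n}. w k * D k)"
    using w D_nonneg by (intro sum_nonneg) auto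
  moreover have disj: "{0, 1, 2, 3} \<inter> {4..n} = {}" by auto
  moreover have "(\<Sum>k\<le>n. w k * D k) = (\<Sum>k\<in>{0, 1, 2, 3}. w k * D k) + (\<Sum>k\<in>{4..n}. w k * D k)"
  proof -
    have "{..n} = {0, 1, 2, 3} \<union> {4..n}" using \<open>3 \<le> n\<close> by auto
    then show ?thesis by (metis (no_types, lifting) sum.union_disjoint finite.intros finite_atLeastAtMost disj)
  qed
  ultimately have "0 \<le> (\<Sum>k\<le>n. w k * D k)"
    using \<open>D 0 = D 2\<close> \<open>D 1 = 0\<close> by (simp add: algebra_simps)
  moreover have "0 \<ge> (\<Sum>k\<le>n. w k) * autocorrelation v 0"
    using w(4) has_sum_nonneg[OF has_sum_autocorrelation[OF assms(2), of 0 0]]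
    by (simp add: mult_nonpos_nonneg)
  moreover have "(\<Sum>k\<le>n. w k * autocorrelation v (int k - 1)) =
      (\<Sum>k\<le>n. w k) * autocorrelation v 0 - (\<Sum>k\<le>n. w k * D k)"
    by (simp add: D_def sum_distrib_right sum_subtractf[symmetric] right_diff_distrib)
  ultimately show ?thesis by simp
qed

lemma wsgd_diff_dissipative:
  assumes "dissipative_weights (wsgd_coeff pq \<gamma>)" "0 \<le> K1" "0 \<le> K2" "V 0 = 0" "V N = 0"
  shows "(\<Sum>i=1..N - 1. V i * wsgd_diff pq \<gamma> K1 K2 h N V i) \<le> 0"
\<comment> \<open>For N \<le> 1 there are no interior points. Otherwise N + 1 \<ge> 3, as the bound
  on the weighted autocorrelations requires.\<close>
proof (cases "2 \<le> N")
  case False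
  then show ?thesis by simp
next
  case True
  let ?w = "wsgd_coeff pq \<gamma>"
  define v where "v i = (if 0 \<le> i \<and> i \<le> int N then V (nat i) else 0)" for i
  have v: "V i = v (int i)" if "i \<le> N" for i
    using that by (simp add: v_def)
  have v0: "v i = 0" if "i \<le> 0 \<or> int N \<le> i" for i
  proof (cases "i = 0 \<or> i = int N")
    case True
    then show ?thesis using assms by (auto simp: v_def)
  next
    case False
    then show ?thesis using that by (auto simp: v_def)
  qed
  have fin: "finite {i. v i \<noteq> 0}"
    by (rule finite_subset[of _ "{0..int N}"]) (auto simp: v_def)
  \<comment> \<open>The factor \<open>v i\<close> vanishes outside 1..N - 1, so the sum over
    interior points is already the full autocorrelation.\<close>
  have S: "(\<Sum>i=1..N - 1. v (int i) * v (int i + m)) = autocorrelation v m" for m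
  proof -
    have "(\<Sum>i=1..N - 1. v (int i) * v (int i + m)) = (\<Sum>i=1..int N - 1. v i * v (i + m))"
      by (rule sum.reindex_bij_witness[of _ nat int]) (use True in auto)
    moreover have "((\<lambda>i. v i * v (i + m)) has_sum (\<Sum>i=1..int N - 1. v i * v (i + m))) UNIV"
      by (rule has_sum_finite_neutralI) (use v0 in \<open>auto simp: not_le\<close>)
    ultimately show ?thesis
      by (simp add: autocorrelation_def infsumI)
  qed
  \<comment> \<open>Zero extension removes the dependence of the summation range on i: the added
    terms read \<open>v\<close> at negative indices here, and beyond N in the right-sided case. The
    two sums can then be exchanged.\<close>
  have left: "(\<Sum>k=0..i + 1. ?w k * V (i + 1 - k)) = (\<Sum>k\<le>N + 1. ?w k * v (int i + (1 - int k)))"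
    if "i \<in> {1..N - 1}" for i
    using that
    by (intro sum.mono_neutral_cong_left) (auto simp: v0 v of_nat_diff algebra_simps intro!: arg_cong[of _ _ v])
  have right: "(\<Sum>k=0..N - i + 1. ?w k * V (i + k - 1)) = (\<Sum>k\<le>N + 1. ?w k * v (int i + (int k - 1)))"
    if "i \<in> {1..N - 1}" for i
    using that
    by (intro sum.mono_neutral_cong_left) (auto simp: v0 v of_nat_diff algebra_simps intro!: arg_cong[of _ _ v])
  have swap: "(\<Sum>i=1..N - 1. v (int i) * (\<Sum>k\<le>N + 1. ?w k * v (int i + g k))) =
      (\<Sum>k\<le>N + 1. ?w k * autocorrelation v (g k))" for g
    unfolding S[symmetric] sum_distrib_left
    by (subst sum.swap) (simp add: mult.left_commute del: sum.atMost_Suc)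
  have "(\<Sum>i=1..N - 1. V i * wsgd_diff pq \<gamma> K1 K2 h N V i) =
      1 / h powr \<gamma> * (K1 * (\<Sum>i=1..N - 1. v (int i) * (\<Sum>k\<le>N + 1. ?w k * v (int i + (1 - int k))))
                   + K2 * (\<Sum>i=1..N - 1. v (int i) * (\<Sum>k\<le>N + 1. ?w k * v (int i + (int k - 1)))))"
    unfolding sum_distrib_left[of _ _ "{1..N - 1}"] sum.distrib[symmetric]
  proof (intro sum.cong refl)
    fix i assume i: "i \<in> {1..N - 1}"
    then have Vi: "V i = v (int i)" by (intro v) auto
    show "V i * wsgd_diff pq \<gamma> K1 K2 h N V i =
      1 / h powr \<gamma> * (K1 * (v (int i) * (\<Sum>k\<le>N + 1. ?w k * v (int i + (1 - int k))))
                   + K2 * (v (int i) * (\<Sum>k\<le>N + 1. ?w k * v (int i + (int k - 1)))))"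
      unfolding wsgd_diff_def left[OF i] right[OF i] Vi by (simp only: distrib_left mult.left_commute)
  qed
  \<comment> \<open>The left-sided part has shifts 1 - k and the right-sided part k - 1; by symmetry
    of the autocorrelation they merge with coefficient \<open>K1 + K2\<close>.\<close>
  also have "\<dots> = 1 / h powr \<gamma> * (K1 + K2) * (\<Sum>k\<le>N + 1. ?w k * autocorrelation v (int k - 1))"
    unfolding swap using autocorrelation_minus[OF fin, of "int _ - 1"]
    by (simp add: distrib_right distrib_left mult.assoc del: sum.atMost_Suc)
  also have "\<dots> \<le> 0"
    using assms dissipative_weights_autocorrelation[OF assms(1) fin, of "N + 1"] True
    by (intro mult_nonneg_nonpos) auto
  finally show ?thesis .
qed

section \<open>Linearity and commutation of the difference operators\<close>

lemma wsgd_diff_eq_0: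
  assumes "\<And>k. k \<le> N \<Longrightarrow> V k = 0" "1 \<le> i" "i \<le> N - 1"
  shows "wsgd_diff pq \<gamma> K1 K2 h N V i = 0"
  using assms by (simp add: wsgd_diff_def)

lemma wsgd_diff_add:
  "wsgd_diff pq \<gamma> K1 K2 h N (\<lambda>k. V k + s * W k) i =
     wsgd_diff pq \<gamma> K1 K2 h N V i + s * wsgd_diff pq \<gamma> K1 K2 h N W i"
  unfolding wsgd_diff_def
  by (simp only: distrib_left sum.distrib sum_distrib_left mult.assoc mult.left_commute[of _ s] add_ac)

lemma wsgd_diff_diff:
  "wsgd_diff pq \<gamma> K1 K2 h N (\<lambda>k. V k - W k) i = wsgd_diff pq \<gamma> K1 K2 h N V i - wsgd_diff pq \<gamma> K1 K2 h N W i"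
  using wsgd_diff_add[of pq \<gamma> K1 K2 h N V "-1" W i] by simp

lemma wsgd_diff_sum:
  "wsgd_diff pq \<gamma> K1 K2 h N (\<lambda>k. \<Sum>l\<in>A. r l * V l k) i =
     (\<Sum>l\<in>A. r l * wsgd_diff pq \<gamma> K1 K2 h N (V l) i)"
proof (induction A rule: infinite_finite_induct)
  case (insert l A)
  then show ?case
    using wsgd_diff_add[of pq \<gamma> K1 K2 h N "\<lambda>k. \<Sum>l\<in>A. r l * V l k" "r l" "V l" i]
    by (simp add: add.commute)
qed (simp_all add: wsgd_diff_def)

text \<open>At a fixed j the operator in y is a finite linear combination of grid columns, and the
  operator in x is linear, so it passes through the combination.\<close>

lemma delta_x_delta_y_commute:
  "delta_x pq \<alpha> K1 K2 h N (delta_y pq \<beta> L1 L2 h' N' U) i j =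
     delta_y pq \<beta> L1 L2 h' N' (delta_x pq \<alpha> K1 K2 h N U) i j"
proof -
  let ?Dx = "wsgd_diff pq \<alpha> K1 K2 h N" and ?Dy = "wsgd_diff pq \<beta> L1 L2 h' N'" and ?w = "wsgd_coeff pq \<beta>"
  \<comment> \<open>The leading 0 makes the expression match the form V + s * W of
    \<open>wsgd_diff_add\<close> twice.\<close>
  have Dy: "?Dy V j = 0 + L1 / h' powr \<beta> * (\<Sum>k=0..j + 1. ?w k * V (j + 1 - k))
      + L2 / h' powr \<beta> * (\<Sum>k=0..N' - j + 1. ?w k * V (j + k - 1))" for V
    by (simp add: wsgd_diff_def distrib_left)
  have 0: "?Dx (\<lambda>_. 0) i = 0" by (simp add: wsgd_diff_def)
  show ?thesis
    unfolding delta_x_def delta_y_def Dy wsgd_diff_add wsgd_diff_sum 0 ..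
qed

lemma id_plus_commute:
  "id_plus s (delta_x pq \<alpha> K1 K2 h N) (id_plus t (delta_y pq \<beta> L1 L2 h' N') U) =
   id_plus t (delta_y pq \<beta> L1 L2 h' N') (id_plus s (delta_x pq \<alpha> K1 K2 h N) U)"
proof (intro ext)
  fix i j
  have x: "delta_x pq \<alpha> K1 K2 h N (\<lambda>i j. V i j + t * W i j) i j =
     delta_x pq \<alpha> K1 K2 h N V i j + t * delta_x pq \<alpha> K1 K2 h N W i j" for V W
    by (simp add: delta_x_def wsgd_diff_add)
  have y: "delta_y pq \<beta> L1 L2 h' N' (\<lambda>i j. V i j + s * W i j) i j =
     delta_y pq \<beta> L1 L2 h' N' V i j + s * delta_y pq \<beta> L1 L2 h' N' W i j" for V W
    by (simp add: delta_y_def wsgd_diff_add)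
  show "id_plus s (delta_x pq \<alpha> K1 K2 h N) (id_plus t (delta_y pq \<beta> L1 L2 h' N') U) i j =
   id_plus t (delta_y pq \<beta> L1 L2 h' N') (id_plus s (delta_x pq \<alpha> K1 K2 h N) U) i j"
    by (simp add: id_plus_def x y delta_x_delta_y_commute algebra_simps)
qed

section \<open>Norms over the interior grid points\<close>

lemma L2_set_dissipative:
  assumes "(\<Sum>x\<in>A. f x * g x) \<le> 0" "0 \<le> s"
  shows "L2_set (\<lambda>x. f x + s * g x) A \<le> L2_set (\<lambda>x. f x + (- s) * g x) A"
    and "L2_set f A \<le> L2_set (\<lambda>x. f x + (- s) * g x) A"
proof -
  \<comment> \<open>Between r = s and r = - s only the cross term changes, and it is nonpositive for
    r = s.\<close>
  have expand: "(\<Sum>x\<in>A. (f x + r * g x)\<^sup>2) =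
      (\<Sum>x\<in>A. (f x)\<^sup>2) + 2 * r * (\<Sum>x\<in>A. f x * g x) + r\<^sup>2 * (\<Sum>x\<in>A. (g x)\<^sup>2)" for r
    by (simp add: sum_distrib_left sum.distrib[symmetric] power2_eq_square algebra_simps)
  have neg: "2 * s * (\<Sum>x\<in>A. f x * g x) \<le> 0"
    using assms by (simp add: mult_nonneg_nonpos)
  have sq: "0 \<le> s\<^sup>2 * (\<Sum>x\<in>A. (g x)\<^sup>2)"
    by (simp add: sum_nonneg)
  show "L2_set (\<lambda>x. f x + s * g x) A \<le> L2_set (\<lambda>x. f x + (- s) * g x) A"
    unfolding L2_set_def expand using neg by (intro real_sqrt_le_mono) simp
  show "L2_set f A \<le> L2_set (\<lambda>x. f x + (- s) * g x) A"
    unfolding L2_set_def expand using neg sq by (intro real_sqrt_le_mono) simp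
qed

text \<open>Leaving out the weight h makes this a plain Euclidean norm;
  \<open>discrete_L2_norm_eq\<close> restores the weight.\<close>

definition interior_norm :: "nat \<Rightarrow> grid \<Rightarrow> real" where
  "interior_norm N U = L2_set (\<lambda>(i, j). U i j) ({1..N - 1} \<times> {1..N - 1})"

lemma discrete_L2_norm_eq:
  "0 \<le> h \<Longrightarrow> discrete_L2_norm h N U = h * interior_norm N U"
  by (simp add: discrete_L2_norm_def interior_norm_def L2_set_def sum.cartesian_product
      real_sqrt_mult case_prod_unfold)

lemma interior_norm_dissipative:
  assumes "(\<Sum>i=1..N - 1. \<Sum>j=1..N - 1. U i j * D U i j) \<le> 0" "0 \<le> s"
  shows "interior_norm N (id_plus s D U) \<le> interior_norm N (id_plus (- s) D U)"
    and "interior_norm N U \<le> interior_norm N (id_plus (- s) D U)"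
proof -
  let ?A = "{1..N - 1} \<times> {1..N - 1}"
  have "(\<Sum>p\<in>?A. U (fst p) (snd p) * D U (fst p) (snd p)) \<le> 0"
    using assms(1) by (simp add: sum.cartesian_product case_prod_unfold)
  from L2_set_dissipative[OF this assms(2)]
  show "interior_norm N (id_plus s D U) \<le> interior_norm N (id_plus (- s) D U)"
    and "interior_norm N U \<le> interior_norm N (id_plus (- s) D U)"
    by (simp_all add: interior_norm_def id_plus_def case_prod_unfold)
qed

text \<open>One-dimensional dissipativity is applied along each line of fixed interior j. Zero
  boundary values are asked for on these lines only, so that U may be the image of a grid function
  under the operator in y, whose corner values are not controlled.\<close>

lemma interior_norm_id_plus_delta_x:
  assumes "dissipative_weights (wsgd_coeff pq \<gamma>)" "0 \<le> K1" "0 \<le> K2" "0 \<le> s"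
    and "\<And>j. j \<in> {1..N - 1} \<Longrightarrow> U 0 j = 0" "\<And>j. j \<in> {1..N - 1} \<Longrightarrow> U N j = 0"
  shows "interior_norm N (id_plus s (delta_x pq \<gamma> K1 K2 h N) U) \<le>
      interior_norm N (id_plus (- s) (delta_x pq \<gamma> K1 K2 h N) U)"
    and "interior_norm N U \<le> interior_norm N (id_plus (- s) (delta_x pq \<gamma> K1 K2 h N) U)"
proof -
  have "(\<Sum>i=1..N - 1. \<Sum>j=1..N - 1. U i j * delta_x pq \<gamma> K1 K2 h N U i j) \<le> 0"
    unfolding delta_x_def
    by (subst sum.swap) (intro sum_nonpos wsgd_diff_dissipative assms)
  from interior_norm_dissipative[where D = "delta_x pq \<gamma> K1 K2 h N", OF this assms(4)]
  show "interior_norm N (id_plus s (delta_x pq \<gamma> K1 K2 h N) U) \<le>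
      interior_norm N (id_plus (- s) (delta_x pq \<gamma> K1 K2 h N) U)"
    and "interior_norm N U \<le> interior_norm N (id_plus (- s) (delta_x pq \<gamma> K1 K2 h N) U)" .
qed

lemma interior_norm_id_plus_delta_y:
  assumes "dissipative_weights (wsgd_coeff pq \<gamma>)" "0 \<le> K1" "0 \<le> K2" "0 \<le> s"
    and "\<And>i. i \<in> {1..N - 1} \<Longrightarrow> U i 0 = 0" "\<And>i. i \<in> {1..N - 1} \<Longrightarrow> U i N = 0"
  shows "interior_norm N (id_plus s (delta_y pq \<gamma> K1 K2 h N) U) \<le>
      interior_norm N (id_plus (- s) (delta_y pq \<gamma> K1 K2 h N) U)"
    and "interior_norm N U \<le> interior_norm N (id_plus (- s) (delta_y pq \<gamma> K1 K2 h N) U)"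
proof -
  have "(\<Sum>i=1..N - 1. \<Sum>j=1..N - 1. U i j * delta_y pq \<gamma> K1 K2 h N U i j) \<le> 0"
    unfolding delta_y_def
    by (intro sum_nonpos wsgd_diff_dissipative assms)
  from interior_norm_dissipative[where D = "delta_y pq \<gamma> K1 K2 h N", OF this assms(4)]
  show "interior_norm N (id_plus s (delta_y pq \<gamma> K1 K2 h N) U) \<le>
      interior_norm N (id_plus (- s) (delta_y pq \<gamma> K1 K2 h N) U)"
    and "interior_norm N U \<le> interior_norm N (id_plus (- s) (delta_y pq \<gamma> K1 K2 h N) U)" .
qed

lemma interior_norm_triangle:
  "interior_norm N (\<lambda>i j. U i j + V i j) \<le> interior_norm N U + interior_norm N V"
  using L2_set_triangle_ineq[of "\<lambda>(i, j). U i j" "\<lambda>(i, j). V i j" "{1..N - 1} \<times> {1..N - 1}"]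
  by (simp add: interior_norm_def case_prod_unfold)

lemma interior_norm_cong:
  assumes "\<And>i j. i \<in> {1..N - 1} \<Longrightarrow> j \<in> {1..N - 1} \<Longrightarrow> U i j = V i j"
  shows "interior_norm N U = interior_norm N V"
  unfolding interior_norm_def by (rule L2_set_cong) (use assms in auto)

text \<open>There are (N - 1)^2 interior points, so the root of their number is below N. Multiplied
  by h, this N later becomes the side length.\<close>

lemma interior_norm_le_bound:
  assumes "\<And>i j. i \<in> {1..N - 1} \<Longrightarrow> j \<in> {1..N - 1} \<Longrightarrow> \<bar>U i j\<bar> \<le> B" "0 \<le> B"
  shows "interior_norm N U \<le> real N * B"
proof -
  have "interior_norm N U \<le> L2_set (\<lambda>_. B) ({1..N - 1} \<times> {1..N - 1})"
    unfolding interior_norm_def L2_set_def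
    by (intro real_sqrt_le_mono sum_mono) (use assms in \<open>auto simp: abs_le_square_iff[symmetric]\<close>)
  also have "\<dots> = real (N - 1) * B"
    using assms(2) by (simp add: L2_set_constant)
  also have "\<dots> \<le> real N * B"
    using assms(2) by (intro mult_right_mono) auto
  finally show ?thesis .
qed

section \<open>Stability of the scheme\<close>

lemma scheme_stability:
  fixes e \<epsilon> :: "nat \<Rightarrow> grid"
  assumes w: "dissipative_weights (wsgd_coeff pq \<alpha>)" "dissipative_weights (wsgd_coeff pq \<beta>)"
    and K: "0 \<le> K1" "0 \<le> K2" "0 \<le> L1" "0 \<le> L2"
    and "0 \<le> \<tau>" "0 \<le> B"
    and dx_def: "dx = delta_x pq \<alpha> K1 K2 h N" and dy_def: "dy = delta_y pq \<beta> L1 L2 h N"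
    and boundary: "\<And>n i j. \<lbrakk>n \<le> M; i \<le> N; j \<le> N; i = 0 \<or> i = N \<or> j = 0 \<or> j = N\<rbrakk> \<Longrightarrow> e n i j = 0"
    and initial: "\<And>i j. \<lbrakk>i \<le> N; j \<le> N\<rbrakk> \<Longrightarrow> e 0 i j = 0"
    and step: "\<And>n i j. \<lbrakk>n < M; i \<in> {1..N - 1}; j \<in> {1..N - 1}\<rbrakk> \<Longrightarrow>
      scheme_lhs dx dy \<tau> (e (Suc n)) i j = scheme_rhs dx dy \<tau> (\<epsilon> n) (e n) i j"
    and bound: "\<And>n i j. \<lbrakk>n < M; i \<in> {1..N - 1}; j \<in> {1..N - 1}\<rbrakk> \<Longrightarrow> \<bar>\<epsilon> n i j\<bar> \<le> B"
    and "n \<le> M"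
  shows "interior_norm N (e n) \<le> real n * \<tau> * (real N * B)"
proof -
  define s where "s = \<tau> / 2"
  have "0 \<le> s" using \<open>0 \<le> \<tau>\<close> by (simp add: s_def)
  \<comment> \<open>On the sides i = 0 and i = N the function \<open>e n\<close> vanishes along the
    whole line, hence so does its difference in y. Thus dissipativity in x applies to the image of
    \<open>e n\<close> under the operator in y.\<close>
  have id_plus_y_eq_0: "id_plus t dy (e n) i j = 0"
    if "n \<le> M" "i = 0 \<or> i = N" "j \<in> {1..N - 1}" for n i j t
  proof -
    have "dy (e n) i j = 0"
      unfolding dy_def delta_y_def by (rule wsgd_diff_eq_0) (use that boundary in auto)
    moreover have "e n i j = 0" using that boundary by auto
    ultimately show ?thesis by (simp add: id_plus_def)
  qed
  have id_plus_x_eq_0: "id_plus t dx (e n) i j = 0"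
    if "n \<le> M" "j = 0 \<or> j = N" "i \<in> {1..N - 1}" for n i j t
  proof -
    have "dx (e n) i j = 0"
      unfolding dx_def delta_x_def by (rule wsgd_diff_eq_0) (use that boundary in auto)
    moreover have "e n i j = 0" using that boundary by auto
    ultimately show ?thesis by (simp add: id_plus_def)
  qed
  define E where "E n = interior_norm N (id_plus (- s) dx (id_plus (- s) dy (e n)))" for n
  have E_0: "E 0 = 0"
  proof -
    \<comment> \<open>The boundary values i = 0 and i = N are included because the difference in x
      at an interior point may read them.\<close>
    have y: "id_plus (- s) dy (e 0) i j = 0" if "i \<le> N" "j \<in> {1..N - 1}" for i j
      using that initial by (auto simp: id_plus_def dy_def delta_y_def wsgd_diff_eq_0)
    have "id_plus (- s) dx (id_plus (- s) dy (e 0)) i j = 0" if "i \<in> {1..N - 1}" "j \<in> {1..N - 1}" for i j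
    proof -
      have "dx (id_plus (- s) dy (e 0)) i j = 0"
        unfolding dx_def delta_x_def by (rule wsgd_diff_eq_0) (use that y in auto)
      then show ?thesis using y[OF _ that(2), of i] that(1) by (auto simp: id_plus_def[of _ dx])
    qed
    then show ?thesis
      by (auto simp: E_def interior_norm_def intro!: L2_set_0')
  qed
  have E_Suc: "E (Suc n) \<le> E n + \<tau> * (real N * B)" if "n < M" for n
  proof -
    have "E (Suc n) = interior_norm N (scheme_rhs dx dy \<tau> (\<epsilon> n) (e n))"
      unfolding E_def
      by (rule interior_norm_cong) (use step that in \<open>simp add: scheme_lhs_def s_def\<close>)
    also have "\<dots> \<le> interior_norm N (id_plus s dx (id_plus s dy (e n))) + interior_norm N (\<lambda>i j. \<tau> * \<epsilon> n i j)"
      unfolding scheme_rhs_def s_def by (rule interior_norm_triangle)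
    also have "interior_norm N (\<lambda>i j. \<tau> * \<epsilon> n i j) \<le> real N * (\<tau> * B)"
      by (rule interior_norm_le_bound)
        (use \<open>0 \<le> \<tau>\<close> \<open>0 \<le> B\<close> bound that in \<open>auto simp: abs_mult intro!: mult_left_mono\<close>)
    \<comment> \<open>The signs are flipped one factor at a time: first in x, then, after commuting,
      in y. Each time the outer factor acts on a function with zero values on the two sides that
      matter.\<close>
    also have "interior_norm N (id_plus s dx (id_plus s dy (e n))) \<le> interior_norm N (id_plus (- s) dx (id_plus s dy (e n)))"
      unfolding dx_def
      by (rule interior_norm_id_plus_delta_x) (use w K \<open>0 \<le> s\<close> id_plus_y_eq_0 that in auto)
    also have "\<dots> = interior_norm N (id_plus s dy (id_plus (- s) dx (e n)))"
      unfolding dx_def dy_def by (simp only: id_plus_commute)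
    also have "\<dots> \<le> interior_norm N (id_plus (- s) dy (id_plus (- s) dx (e n)))"
      unfolding dy_def
      by (rule interior_norm_id_plus_delta_y) (use w K \<open>0 \<le> s\<close> id_plus_x_eq_0 that in auto)
    also have "\<dots> = E n"
      unfolding E_def dx_def dy_def by (simp only: id_plus_commute)
    finally show ?thesis by (simp add: algebra_simps)
  qed
  \<comment> \<open>The energy dominates the norm: each factor with negative sign can only increase
    it.\<close>
  have "interior_norm N (e n) \<le> interior_norm N (id_plus (- s) dy (e n))"
    unfolding dy_def
    by (rule interior_norm_id_plus_delta_y) (use w K \<open>0 \<le> s\<close> boundary \<open>n \<le> M\<close> in auto)
  also have "\<dots> \<le> E n"
    unfolding E_def dx_def
    by (rule interior_norm_id_plus_delta_x) (use w K \<open>0 \<le> s\<close> id_plus_y_eq_0 \<open>n \<le> M\<close> in auto)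
  also have "\<dots> \<le> real n * \<tau> * (real N * B)"
    using \<open>n \<le> M\<close>
  proof (induction n)
    case (Suc n)
    then show ?case using E_Suc[of n] by (simp add: algebra_simps)
  qed (simp add: E_0)
  finally show ?thesis .
qed

section \<open>The error equation and convergence\<close>

lemma id_plus_delta_diff:
  "id_plus s (delta_x pq \<gamma> K1 K2 h N) (\<lambda>i j. U i j - V i j) =
    (\<lambda>i j. id_plus s (delta_x pq \<gamma> K1 K2 h N) U i j - id_plus s (delta_x pq \<gamma> K1 K2 h N) V i j)"
  "id_plus s (delta_y pq \<gamma> K1 K2 h N) (\<lambda>i j. U i j - V i j) =
    (\<lambda>i j. id_plus s (delta_y pq \<gamma> K1 K2 h N) U i j - id_plus s (delta_y pq \<gamma> K1 K2 h N) V i j)"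
  by (simp_all add: id_plus_def delta_x_def delta_y_def wsgd_diff_diff fun_eq_iff algebra_simps)

theorem theorem7:
  fixes a b c d T \<alpha> \<beta> K1p K2p K1m K2m :: real
    and p q :: int
    and f \<phi> u :: "real \<Rightarrow> real \<Rightarrow> real \<Rightarrow> real"
    and u0 :: "real \<Rightarrow> real \<Rightarrow> real"
  assumes "a < b" and "c < d" and equal_steps: "b - a = d - c" and "0 < T"
    and "1 < \<alpha>" "\<alpha> \<le> 2" and "1 < \<beta>" "\<beta> \<le> 2"
    and "K1p \<ge> 0" "K2p \<ge> 0" "K1m \<ge> 0" "K2m \<ge> 0"
    and "K1p\<^sup>2 + K2p\<^sup>2 \<noteq> 0" and "K1m\<^sup>2 + K2m\<^sup>2 \<noteq> 0"
    and "(p, q) \<in> {(1, 0), (1, -1)}"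
    and "K1p \<noteq> 0 \<Longrightarrow> \<forall>y\<in>{c..d}. \<forall>t\<in>{0..T}. \<phi> a y t = 0"
    and "K2p \<noteq> 0 \<Longrightarrow> \<forall>y\<in>{c..d}. \<forall>t\<in>{0..T}. \<phi> b y t = 0"
    and "K1m \<noteq> 0 \<Longrightarrow> \<forall>x\<in>{a..b}. \<forall>t\<in>{0..T}. \<phi> x c t = 0"
    and "K2m \<noteq> 0 \<Longrightarrow> \<forall>x\<in>{a..b}. \<forall>t\<in>{0..T}. \<phi> x d t = 0"
    and "exact_solution (p, q) a b c d T \<alpha> \<beta> K1p K2p K1m K2m f u0 \<phi> u"
  shows "\<exists>C>0. \<forall>N\<ge>1. \<forall>M\<ge>1. \<forall>U.
           solves_scheme (p, q) a b c T \<alpha> \<beta> K1p K2p K1m K2m f u0 \<phi> N M U \<longrightarrow>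
           (let h = (b - a) / real N; \<tau> = T / real M in
            \<forall>n\<in>{1..M}.
              discrete_L2_norm h N (\<lambda>i j. on_grid a c h u (real n * \<tau>) i j - U n i j)
                \<le> C * (\<tau>\<^sup>2 + h\<^sup>2))"
proof -
  have problem: "solves_problem a b c d T \<alpha> \<beta> K1p K2p K1m K2m f u0 \<phi> u"
    and "consistent_second_order (p, q) a b c T \<alpha> \<beta> K1p K2p K1m K2m f u"
    using assms by (auto simp: exact_solution_def smooth_solution_def)
  then obtain ctil where ctil: "\<And>N M. \<lbrakk>1 \<le> N; 1 \<le> M\<rbrakk> \<Longrightarrow>
        let h = (b - a) / real N; \<tau> = T / real M;
            dx = delta_x (p, q) \<alpha> K1p K2p h N; dy = delta_y (p, q) \<beta> K1m K2m h N in
        \<exists>\<epsilon> :: nat \<Rightarrow> grid. \<forall>n<M. \<forall>i\<in>{1..N - 1}. \<forall>j\<in>{1..N - 1}.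
          scheme_lhs dx dy \<tau> (on_grid a c h u (real (n + 1) * \<tau>)) i j =
          scheme_rhs dx dy \<tau> (on_grid a c h f (half_time \<tau> n)) (on_grid a c h u (real n * \<tau>)) i j
            + \<tau> * \<epsilon> n i j \<and>
          \<bar>\<epsilon> n i j\<bar> \<le> ctil * (\<tau>\<^sup>2 + h\<^sup>2)"
    unfolding consistent_second_order_def by blast
  have initial: "u x y 0 = u0 x y" if "x \<in> {a<..<b}" "y \<in> {c<..<d}" for x y
    using problem that unfolding solves_problem_def by blast
  have boundary: "u x y t = \<phi> x y t"
    if "x \<in> {a..b}" "y \<in> {c..d}" "x = a \<or> x = b \<or> y = c \<or> y = d" "t \<in> {0..T}" for x y t
  proof -
    have "frontier ({a<..<b} \<times> {c<..<d}) = {a..b} \<times> {c..d} - {a<..<b} \<times> {c<..<d}"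
      using \<open>a < b\<close> \<open>c < d\<close> by (simp add: frontier_def closure_Times interior_open open_Times)
    then have "(x, y) \<in> frontier ({a<..<b} \<times> {c<..<d})" using that by auto
    then show ?thesis using problem that unfolding solves_problem_def by blast
  qed
  \<comment> \<open>\<open>ctil\<close> is fixed before N and M, so C depends on neither. The
    absolute value covers a \<open>ctil\<close> of any sign, and the summand 1 makes C
    positive.\<close>
  define C where "C = T * (b - a) * \<bar>ctil\<bar> + 1"
  have "0 < C" using assms by (simp add: C_def add_nonneg_pos)
  moreover have "discrete_L2_norm h N (\<lambda>i j. on_grid a c h u (real n * \<tau>) i j - U n i j) \<le> C * (\<tau>\<^sup>2 + h\<^sup>2)"
    if "1 \<le> N" "1 \<le> M" and scheme: "solves_scheme (p, q) a b c T \<alpha> \<beta> K1p K2p K1m K2m f u0 \<phi> N M U"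
      and h: "h = (b - a) / real N" and \<tau>: "\<tau> = T / real M" and n: "n \<in> {1..M}" for N M U h \<tau> n
  proof -
    define dx where "dx = delta_x (p, q) \<alpha> K1p K2p h N"
    define dy where "dy = delta_y (p, q) \<beta> K1m K2m h N"
    define e where "e n = (\<lambda>i j. on_grid a c h u (real n * \<tau>) i j - U n i j)" for n
    define B where "B = \<bar>ctil\<bar> * (\<tau>\<^sup>2 + h\<^sup>2)"
    have pos: "0 < h" "0 < \<tau>" "0 \<le> B"
      using assms that by (auto simp: B_def)
    have Nh: "real N * h = b - a" and M\<tau>: "real M * \<tau> = T"
      using that by auto
    have x_grid: "a + real i * h \<in> {a..b}" "c + real i * h \<in> {c..d}" if "i \<le> N" for i
      using mult_right_mono[of "real i" "real N" h] that pos Nh equal_steps by auto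
    have x_interior: "a + real i * h \<in> {a<..<b}" "c + real i * h \<in> {c<..<d}" if "0 < i" "i < N" for i
      using mult_strict_right_mono[of "real i" "real N" h] that pos Nh equal_steps by auto
    have t_grid: "real n * \<tau> \<in> {0..T}" if "n \<le> M" for n
      using mult_right_mono[of "real n" "real M" \<tau>] that pos M\<tau> by auto
    have scheme_step: "scheme_lhs dx dy \<tau> (U (n + 1)) i j =
         scheme_rhs dx dy \<tau> (on_grid a c h f (half_time \<tau> n)) (U n) i j"
      if "n < M" "i \<in> {1..N - 1}" "j \<in> {1..N - 1}" for n i j
      using scheme that unfolding solves_scheme_def Let_def h[symmetric] \<tau>[symmetric] dx_def[symmetric] dy_def[symmetric]
      by blast
    have scheme_initial: "U 0 i j = u0 (a + real i * h) (c + real j * h)"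
      if "i \<in> {1..N - 1}" "j \<in> {1..N - 1}" for i j
      using scheme that unfolding solves_scheme_def Let_def h[symmetric] by blast
    have scheme_boundary: "U n i j = on_grid a c h \<phi> (real n * \<tau>) i j"
      if "n \<le> M" "i \<le> N" "j \<le> N" "i = 0 \<or> i = N \<or> j = 0 \<or> j = N" for n i j
      using scheme that unfolding solves_scheme_def Let_def h[symmetric] \<tau>[symmetric] by blast
    have e_boundary: "e n i j = 0"
      if "n \<le> M" "i \<le> N" "j \<le> N" "i = 0 \<or> i = N \<or> j = 0 \<or> j = N" for n i j
      using that scheme_boundary[OF that] boundary[OF x_grid(1) x_grid(2) _ t_grid, of i j n] Nh equal_steps
      by (auto simp: e_def on_grid_def)
    \<comment> \<open>The scheme prescribes \<open>U 0\<close> through \<open>u0\<close> at interior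
      points only; at boundary points both u and U take the values of \<phi>.\<close>
    have e_initial: "e 0 i j = 0" if "i \<le> N" "j \<le> N" for i j
    proof (cases "i = 0 \<or> i = N \<or> j = 0 \<or> j = N")
      case True
      with that show ?thesis by (intro e_boundary) auto
    next
      case False
      then have "i \<in> {1..N - 1}" "j \<in> {1..N - 1}" using that by auto
      then show ?thesis
        using that False scheme_initial[of i j] initial[OF x_interior(1) x_interior(2), of i j]
        by (simp add: e_def on_grid_def)
    qed
    obtain \<epsilon> :: "nat \<Rightarrow> grid" where \<epsilon>: "\<And>n i j. \<lbrakk>n < M; i \<in> {1..N - 1}; j \<in> {1..N - 1}\<rbrakk> \<Longrightarrow>
          scheme_lhs dx dy \<tau> (on_grid a c h u (real (n + 1) * \<tau>)) i j =
          scheme_rhs dx dy \<tau> (on_grid a c h f (half_time \<tau> n)) (on_grid a c h u (real n * \<tau>)) i j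
            + \<tau> * \<epsilon> n i j \<and>
          \<bar>\<epsilon> n i j\<bar> \<le> ctil * (\<tau>\<^sup>2 + h\<^sup>2)"
      using ctil[OF \<open>1 \<le> N\<close> \<open>1 \<le> M\<close>]
      unfolding Let_def h[symmetric] \<tau>[symmetric] dx_def[symmetric] dy_def[symmetric] by blast
    \<comment> \<open>Subtracting the scheme from the consistency relation cancels f and leaves the
      truncation error as the source.\<close>
    have e_step: "scheme_lhs dx dy \<tau> (e (Suc n)) i j = scheme_rhs dx dy \<tau> (\<epsilon> n) (e n) i j"
      if "n < M" "i \<in> {1..N - 1}" "j \<in> {1..N - 1}" for n i j
      using \<epsilon>[OF that] scheme_step[OF that]
      unfolding e_def scheme_lhs_def scheme_rhs_def dx_def dy_def id_plus_delta_diff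
      by (simp add: algebra_simps)
    have \<epsilon>_bound: "\<bar>\<epsilon> n i j\<bar> \<le> B" if "n < M" "i \<in> {1..N - 1}" "j \<in> {1..N - 1}" for n i j
    proof -
      have "\<bar>\<epsilon> n i j\<bar> \<le> ctil * (\<tau>\<^sup>2 + h\<^sup>2)"
        using \<epsilon>[OF that] by (rule conjunct2)
      also have "\<dots> \<le> B"
        unfolding B_def by (intro mult_right_mono abs_ge_self sum_power2_ge_zero)
      finally show ?thesis .
    qed
    have w: "dissipative_weights (wsgd_coeff (p, q) \<alpha>)" "dissipative_weights (wsgd_coeff (p, q) \<beta>)"
      using assms by (intro dissipative_weights_wsgd_coeff; simp)+
    have "n \<le> M" using n by simp
    have "interior_norm N (e n) \<le> real n * \<tau> * (real N * B)"
      by (rule scheme_stability[OF w \<open>0 \<le> K1p\<close> \<open>0 \<le> K2p\<close> \<open>0 \<le> K1m\<close> \<open>0 \<le> K2m\<close> less_imp_le[OF pos(2)] pos(3)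
          dx_def dy_def e_boundary e_initial e_step \<epsilon>_bound \<open>n \<le> M\<close>])
    then have "discrete_L2_norm h N (e n) \<le> h * (real n * \<tau> * (real N * B))"
      using pos by (simp add: discrete_L2_norm_eq mult_left_mono)
    \<comment> \<open>The weight h of the norm cancels the factor N, as N h = b - a; next, n \<tau>
      \<le> T removes the dependence on n.\<close>
    also have "\<dots> = real n * \<tau> * ((b - a) * B)"
      by (simp add: Nh[symmetric])
    also have "\<dots> \<le> T * ((b - a) * B)"
      using t_grid[of n] n pos assms by (intro mult_right_mono) auto
    also have "\<dots> \<le> C * (\<tau>\<^sup>2 + h\<^sup>2)"
      by (simp add: C_def B_def algebra_simps)
    finally show ?thesis unfolding e_def .
  qed
  ultimately show ?thesis unfolding Let_def by blast
qed

end
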